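(* Let $X$ be a real Banach space, $V \in CL(X)$ and $\mathcal{F} \subseteq CB(X)$. Then the following statements are equivalent. (1) $(V, \mathcal{F})$ has property-$(lP_2)$. (2) For every $\epsilon>0$ and $F \in \mathcal{F}$ there exists $\delta>0$ such that $Z_V(F, \delta) \subseteq Z_V(G)+ \epsilon B_X$ whenever $G \in \mathcal{F}$ and $\mathcal{H}(F,G)< \delta$. (3) $(V, \mathcal{F})$ has property-$(P_1)$ and the map $Z_V$ is lower Hausdorff semi-continuous on $(\mathcal{F}, \mathcal{H})$.
   Context: $CL(X)$ and $CB(X)$ denote the sets of non-empty closed, respectively non-empty closed bounded, subsets of $X$; $B_X$ is the closed unit ball. For $x\in X$ and $F\in CB(X)$, $r(x,F)=\sup\{\|x-a\|: a\in F\}$. For $V\in CL(X)$, $rad_V(F)=\inf\{r(v,F): v\in V\}$, $Z_V(F)=\{v\in V: r(v,F)=rad_V(F)\}$, and for $\delta\ge 0$, $Z_V(F,\delta)=\{v\in V: r(v,F)\le rad_V(F)+\delta\}$. $\mathcal{H}$ is the Hausdorff metric on $CB(X)$: $\mathcal{H}(A,B)=\inf\{r>0: A\subseteq B+rB_X,\ B\subseteq A+rB_X\}$. $Z_V$ also denotes the restricted center map $F\mapsto Z_V(F)$. $(V,\mathcal{F})$ has property-$(P_1)$ if for every $G\in\mathcal{F}$: $Z_V(G)\neq\emptyset$ and for every $\epsilon>0$ there exists $\delta>0$ such that $Z_V(G,\delta)\subseteq Z_V(G)+\epsilon B_X$. $(V,\mathcal{F})$ has property-$(lP_2)$ if $Z_V(G)\neq\emptyset$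 for every $G\in\mathcal{F}$, and for every $\epsilon>0$ and $F\in\mathcal{F}$ there exists $\delta>0$ such that $Z_V(G,\delta)\subseteq Z_V(G)+\epsilon B_X$ whenever $G\in\mathcal{F}$ and $\mathcal{H}(F,G)<\delta$. A map $T$ from a metric space $(N,d)$ to $(CB(X),\mathcal{H})$ is lower Hausdorff semi-continuous on $N$ if for every $a_0\in N$ and $\epsilon>0$ there exists $\delta>0$ such that $T(a_0)\subseteq T(a)+\epsilon B_X$ whenever $a\in N$ and $d(a,a_0)<\delta$. *)

theory Defs
  imports "HOL-Analysis.Analysis"
begin

definition CL :: "'a::real_normed_vector set set" where
  "CL = {A. A \<noteq> {} \<and> closed A}"

definition CB :: "'a::real_normed_vector set set" where
  "CB = {A. A \<noteq> {} \<and> closed A \<and> bounded A}"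

(* A + e B_X: a Minkowski sum (the set addition of Set_Algebras), in general not closed. *)
definition enlarge :: "'a::real_normed_vector set \<Rightarrow> real \<Rightarrow> 'a set" where
  "enlarge A e = A + (\<lambda>x. e *\<^sub>R x) ` cball 0 1"

(* The real-valued SUP and INF below are the genuine supremum and infimum only because
   F is nonempty and bounded and V is nonempty. *)
definition radius :: "'a::real_normed_vector \<Rightarrow> 'a set \<Rightarrow> real" where
  "radius x F = (SUP a\<in>F. norm (x - a))"

definition restr_rad :: "'a::real_normed_vector set \<Rightarrow> 'a set \<Rightarrow> real" where
  "restr_rad V F = (INF v\<in>V. radius v F)"

definition restr_center :: "'a::real_normed_vector set \<Rightarrow> 'a set \<Rightarrow> 'a set" where
  "restr_center V F = {v \<in> V. radius v F = restr_rad V F}"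

definition near_restr_center :: "'a::real_normed_vector set \<Rightarrow> 'a set \<Rightarrow> real \<Rightarrow> 'a set" where
  "near_restr_center V F \<delta> = {v \<in> V. radius v F \<le> restr_rad V F + \<delta>}"

definition hausdorff :: "'a::real_normed_vector set \<Rightarrow> 'a set \<Rightarrow> real" where
  "hausdorff A B = Inf {r. r > 0 \<and> A \<subseteq> enlarge B r \<and> B \<subseteq> enlarge A r}"

definition property_P1 :: "'a::real_normed_vector set \<Rightarrow> 'a set set \<Rightarrow> bool" where
  "property_P1 V \<F> \<longleftrightarrow>
     (\<forall>G\<in>\<F>. restr_center V G \<noteq> {} \<and>
       (\<forall>\<epsilon>>0. \<exists>\<delta>>0. near_restr_center V G \<delta> \<subseteq> enlarge (restr_center V G) \<epsilon>))"

definition property_lP2 :: "'a::real_normed_vector set \<Rightarrow> 'a set set \<Rightarrow> bool" where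
  "property_lP2 V \<F> \<longleftrightarrow>
     (\<forall>G\<in>\<F>. restr_center V G \<noteq> {}) \<and>
     (\<forall>\<epsilon>>0. \<forall>F\<in>\<F>. \<exists>\<delta>>0. \<forall>G\<in>\<F>. hausdorff F G < \<delta> \<longrightarrow>
        near_restr_center V G \<delta> \<subseteq> enlarge (restr_center V G) \<epsilon>)"

(* The first conjunct records that T is a map from N into CB(X); d is the metric on N. *)
definition lower_hausdorff_semicontinuous ::
    "'b set \<Rightarrow> ('b \<Rightarrow> 'b \<Rightarrow> real) \<Rightarrow> ('b \<Rightarrow> 'a::real_normed_vector set) \<Rightarrow> bool" where
  "lower_hausdorff_semicontinuous N d T \<longleftrightarrow>
     T \<in> N \<rightarrow> CB \<and>
     (\<forall>a0\<in>N. \<forall>\<epsilon>>0. \<exists>\<delta>>0. \<forall>a\<in>N. d a a0 < \<delta> \<longrightarrow> T a0 \<subseteq> enlarge (T a) \<epsilon>)"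

end

theory Submission
  imports Defs
begin

text \<open>
  If the Hausdorff distance of F and G is less than d, then the radii r(v, F) and r(v, G) differ by
  at most d, uniformly in v, and hence so do the restricted radii. Therefore
  Z_V(F, e) is contained in Z_V(G, e + 2d), and the roles of F and G in (1) and (2) can be
  exchanged at the cost of replacing the given number by a third of it. For (3) implies (2) one
  passes from Z_V(F, e) to Z_V(F) and then to Z_V(G), with half of the tolerance in each step.
\<close>

section \<open>Enlargements as distance conditions\<close>

lemma mem_enlarge_iff:
  assumes "e > 0"
  shows "x \<in> enlarge A e \<longleftrightarrow> (\<exists>a\<in>A. norm (x - a) \<le> e)"
proof
  assume "x \<in> enlarge A e"
  then obtain a b where "a \<in> A" "norm b \<le> 1" "x = a + e *\<^sub>R b"
    unfolding enlarge_def by (auto elim!: set_plus_elim)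
  then show "\<exists>a\<in>A. norm (x - a) \<le> e"
    using assms by (intro bexI[of _ a]) (auto simp: mult_left_le)
next
  assume "\<exists>a\<in>A. norm (x - a) \<le> e"
  then obtain a where a: "a \<in> A" "norm (x - a) \<le> e" by blast
  \<comment> \<open>Solving \<open>x = a + e *\<^sub>R b\<close> for \<open>b\<close>; the bound
    \<open>norm (x - a) \<le> e\<close> puts the solution into the unit ball.\<close>
  let ?b = "(1 / e) *\<^sub>R (x - a)"
  have "norm ?b \<le> 1" "x = a + e *\<^sub>R ?b"
    using a assms by auto
  then show "x \<in> enlarge A e"
    unfolding enlarge_def using a by (metis image_eqI mem_cball_0 set_plus_intro)
qed

lemma enlarge_mono: "A \<subseteq> B \<Longrightarrow> enlarge A e \<subseteq> enlarge B e"
  unfolding enlarge_def by (rule set_plus_mono2) auto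

lemma enlarge_empty [simp]: "enlarge {} e = {}"
  by (auto simp: enlarge_def elim: set_plus_elim)

lemma subset_enlarge: "e > 0 \<Longrightarrow> A \<subseteq> enlarge A e"
  by (force simp: mem_enlarge_iff)

text \<open>The triangle inequality through the intermediate point. This is what lets two tolerances
  of \<open>e / 2\<close> be chained into one of \<open>e\<close>.\<close>

lemma enlarge_enlarge_subset:
  assumes "d > 0" "e > 0"
  shows "enlarge (enlarge A d) e \<subseteq> enlarge A (d + e)"
proof
  fix x assume "x \<in> enlarge (enlarge A d) e"
  then obtain y a where "norm (x - y) \<le> e" "a \<in> A" "norm (y - a) \<le> d"
    using assms mem_enlarge_iff by metis
  moreover have "norm (x - a) \<le> norm (x - y) + norm (y - a)"
    using norm_triangle_ineq[of "x - y" "y - a"] by simp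
  ultimately have "a \<in> A" "norm (x - a) \<le> d + e" by linarith+
  then show "x \<in> enlarge A (d + e)"
    using assms by (auto simp: mem_enlarge_iff)
qed

section \<open>Radii of bounded sets\<close>

lemma bdd_above_norm_diff:
  assumes "bounded F"
  shows "bdd_above ((\<lambda>a. norm (x - a)) ` F)"
proof -
  obtain B where "\<And>a. a \<in> F \<Longrightarrow> norm a \<le> B"
    using assms bounded_iff by blast
  then have "norm (x - a) \<le> norm x + B" if "a \<in> F" for a
    using norm_triangle_ineq4[of x a] that by fastforce
  then show ?thesis by (rule bdd_aboveI2)
qed

lemma norm_diff_le_radius: "bounded F \<Longrightarrow> a \<in> F \<Longrightarrow> norm (x - a) \<le> radius x F"
  unfolding radius_def by (rule cSUP_upper[OF _ bdd_above_norm_diff])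

lemma radius_le:
  assumes "F \<noteq> {}" "\<And>a. a \<in> F \<Longrightarrow> norm (x - a) \<le> c"
  shows "radius x F \<le> c"
  unfolding radius_def using assms by (rule cSUP_least)

text \<open>Any point of \<open>F\<close> gives a nonnegative lower bound. The result serves to
  bound the family of radii from below, so that the infimum in \<open>restr_rad\<close> is a genuine
  one.\<close>

lemma radius_nonneg:
  assumes "F \<in> CB"
  shows "0 \<le> radius x F"
proof -
  obtain a where "a \<in> F" "bounded F" using assms by (auto simp: CB_def)
  then show ?thesis using norm_diff_le_radius[of F a x] norm_ge_zero order_trans by blast
qed

lemma radius_le_radius_add_norm:
  assumes "F \<in> CB"
  shows "radius x F \<le> radius y F + norm (x - y)"
proof (rule radius_le)
  show "F \<noteq> {}" using assms by (simp add: CB_def)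
  fix a assume "a \<in> F"
  then have "norm (y - a) \<le> radius y F"
    using assms by (simp add: CB_def norm_diff_le_radius)
  moreover have "norm (x - a) \<le> norm (x - y) + norm (y - a)"
    using norm_triangle_ineq[of "x - y" "y - a"] by simp
  ultimately show "norm (x - a) \<le> radius y F + norm (x - y)" by linarith
qed

text \<open>The preceding estimate, used in both directions, makes the radius 1-Lipschitz in the
  point. Continuity is wanted for the closedness of the restricted center.\<close>

lemma continuous_on_radius:
  assumes "F \<in> CB"
  shows "continuous_on S (\<lambda>x. radius x F)"
proof (rule continuous_onI)
  fix x and e :: real assume "e > 0"
  moreover have "dist (radius y F) (radius x F) \<le> dist y x" for y
    using radius_le_radius_add_norm[OF assms, of x y] radius_le_radius_add_norm[OF assms, of y x]
    by (simp add: dist_norm norm_minus_commute abs_le_iff)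
  ultimately show "\<exists>d>0. \<forall>y\<in>S. dist y x < d \<longrightarrow> dist (radius y F) (radius x F) \<le> e"
    by (meson less_imp_le order_trans)
qed

text \<open>Each point of \<open>F\<close> has a point of \<open>G\<close> within \<open>d\<close>,
  and the triangle inequality through it bounds the distance from \<open>x\<close>. One inclusion
  gives one inequality.\<close>

lemma radius_le_of_subset_enlarge:
  assumes "F \<noteq> {}" "bounded G" "d > 0" "F \<subseteq> enlarge G d"
  shows "radius x F \<le> radius x G + d"
proof (rule radius_le[OF assms(1)])
  fix a assume "a \<in> F"
  then have "a \<in> enlarge G d" using assms(4) by blast
  then obtain b where "b \<in> G" "norm (a - b) \<le> d"
    using assms(3) by (auto simp: mem_enlarge_iff)
  moreover have "norm (x - a) \<le> norm (x - b) + norm (b - a)"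
    using norm_triangle_ineq[of "x - b" "b - a"] by simp
  ultimately show "norm (x - a) \<le> radius x G + d"
    using norm_diff_le_radius[OF assms(2), of b x] by (simp add: norm_minus_commute)
qed

section \<open>Restricted radii and centers\<close>

lemma restr_rad_le:
  assumes "F \<in> CB" "v \<in> V"
  shows "restr_rad V F \<le> radius v F"
  unfolding restr_rad_def
  by (rule cINF_lower[OF bdd_belowI2[of _ 0]]) (use assms radius_nonneg in auto)

lemma restr_center_subset_near_restr_center:
  "0 \<le> e \<Longrightarrow> restr_center V F \<subseteq> near_restr_center V F e"
  by (auto simp: restr_center_def near_restr_center_def)

text \<open>An infimum over a nonempty set is approximated within any positive \<open>e\<close>,
  even if it is not attained. Later this yields points of the center itself, once near-centers are
  known to lie in an enlargement of it.\<close>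

lemma near_restr_center_nonempty:
  assumes "V \<noteq> {}" "e > 0"
  shows "near_restr_center V F e \<noteq> {}"
proof -
  have "Inf ((\<lambda>v. radius v F) ` V) < restr_rad V F + e"
    using assms by (simp add: restr_rad_def)
  then obtain v where "v \<in> V" "radius v F < restr_rad V F + e"
    using cInf_lessD[of "(\<lambda>v. radius v F) ` V" "restr_rad V F + e"] assms by blast
  then show ?thesis by (force simp: near_restr_center_def)
qed

lemma closed_restr_center:
  assumes "closed V" "F \<in> CB"
  shows "closed (restr_center V F)"
proof -
  have "closed {v. radius v F = restr_rad V F}"
    by (intro closed_Collect_eq continuous_on_radius[OF assms(2)] continuous_on_const)
  then have "closed (V \<inter> {v. radius v F = restr_rad V F})"
    using assms(1) by (rule closed_Int[rotated])
  also have "V \<inter> {v. radius v F = restr_rad V F} = restr_center V F"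
    by (auto simp: restr_center_def)
  finally show ?thesis .
qed

text \<open>Every center lies within \<open>restr_rad V F\<close> of any fixed point of
  \<open>F\<close>. Together with closedness this gives values in \<open>CB\<close>, as lower
  semi-continuity demands.\<close>

lemma bounded_restr_center:
  assumes "F \<in> CB"
  shows "bounded (restr_center V F)"
proof -
  obtain a where a: "a \<in> F" "bounded F" using assms by (auto simp: CB_def)
  have "norm (v - a) \<le> restr_rad V F" if "v \<in> restr_center V F" for v
    using norm_diff_le_radius[OF a(2,1), of v] that by (simp add: restr_center_def)
  then have "restr_center V F \<subseteq> cball a (restr_rad V F)"
    by (auto simp: dist_norm norm_minus_commute)
  then show ?thesis by (rule bounded_subset[OF bounded_cball])
qed

section \<open>Hausdorff distance and its effect on radii\<close>

lemma hausdorff_commute: "hausdorff A B = hausdorff B A"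
  unfolding hausdorff_def by (rule arg_cong[of _ _ Inf]) blast

lemma hausdorff_self_le:
  assumes "e > 0"
  shows "hausdorff A A \<le> e"
  unfolding hausdorff_def
  by (rule cInf_lower[OF _ bdd_belowI[of _ 0]]) (use assms subset_enlarge in auto)

text \<open>A number above an infimum exceeds some member of the set, provided that the set is
  nonempty. Boundedness of \<open>F\<close> and \<open>G\<close> supplies such a member.\<close>

lemma hausdorff_lessE:
  assumes "F \<in> CB" "G \<in> CB" "hausdorff F G < d"
  obtains r where "0 < r" "r < d" "F \<subseteq> enlarge G r" "G \<subseteq> enlarge F r"
proof -
  obtain a b where ab: "a \<in> F" "b \<in> G"
    using assms(1,2) by (auto simp: CB_def)
  obtain B where B: "\<And>x. x \<in> F \<Longrightarrow> norm x \<le> B"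
    using assms(1) by (auto simp: CB_def bounded_iff)
  obtain C where C: "\<And>x. x \<in> G \<Longrightarrow> norm x \<le> C"
    using assms(2) by (auto simp: CB_def bounded_iff)
  \<comment> \<open>\<open>B + C\<close> bounds all distances between points of \<open>F\<close> and
    \<open>G\<close>; the summand 1 keeps \<open>s\<close> positive when both bounds are 0.\<close>
  define s where "s = B + C + 1"
  have "0 \<le> B" "0 \<le> C"
    using B[OF ab(1)] C[OF ab(2)] norm_ge_zero[of a] norm_ge_zero[of b] by linarith+
  then have s: "s > 0" by (simp add: s_def)
  have le: "norm (x - y) \<le> s" "norm (y - x) \<le> s" if "x \<in> F" "y \<in> G" for x y
    using norm_triangle_ineq4[of x y] B[OF that(1)] C[OF that(2)]
    by (auto simp: s_def norm_minus_commute)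
  let ?R = "{r. r > 0 \<and> F \<subseteq> enlarge G r \<and> G \<subseteq> enlarge F r}"
  have "s \<in> ?R"
    using s le ab by (auto simp: mem_enlarge_iff)
  then have "?R \<noteq> {}" by blast
  moreover have "Inf ?R < d"
    using assms(3) by (simp add: hausdorff_def)
  ultimately obtain r where "r \<in> ?R" "r < d"
    using cInf_lessD[of ?R d] by blast
  then show thesis using that[of r] by blast
qed

lemma radius_le_radius_add_hausdorff:
  assumes "F \<in> CB" "G \<in> CB" "hausdorff F G < d"
  shows "radius x F \<le> radius x G + d"
proof -
  obtain r where "0 < r" "r < d" "F \<subseteq> enlarge G r"
    using hausdorff_lessE[OF assms] .
  then show ?thesis
    using radius_le_of_subset_enlarge[of F G r x] assms(1,2) by (simp add: CB_def)
qed

lemma restr_rad_le_restr_rad_add_hausdorff: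
  assumes "V \<noteq> {}" "F \<in> CB" "G \<in> CB" "hausdorff F G < d"
  shows "restr_rad V F \<le> restr_rad V G + d"
proof -
  \<comment> \<open>With \<open>d\<close> moved to the left, the left side is a lower bound
    independent of \<open>v\<close>, so passing to the infimum needs no minimizer.\<close>
  have "restr_rad V F - d \<le> radius v G" if "v \<in> V" for v
    using restr_rad_le[OF assms(2) that] radius_le_radius_add_hausdorff[OF assms(2-4), of v]
    by linarith
  then have "restr_rad V F - d \<le> restr_rad V G"
    unfolding restr_rad_def[of V G] by (rule cINF_greatest[OF assms(1)])
  then show ?thesis by linarith
qed

text \<open>One \<open>d\<close> pays for replacing the radius of \<open>F\<close> at
  \<open>v\<close> by that of \<open>G\<close>, the other for replacing the restricted
  radius.\<close>

lemma near_restr_center_subset_of_hausdorff: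
  assumes "V \<noteq> {}" "F \<in> CB" "G \<in> CB" "hausdorff F G < d"
  shows "near_restr_center V F e \<subseteq> near_restr_center V G (e + 2 * d)"
proof
  fix v assume v: "v \<in> near_restr_center V F e"
  have "hausdorff G F < d"
    using assms(4) by (simp add: hausdorff_commute)
  then have "radius v G \<le> radius v F + d"
    using assms by (intro radius_le_radius_add_hausdorff)
  also have "\<dots> \<le> restr_rad V F + e + d"
    using v by (simp add: near_restr_center_def)
  also have "\<dots> \<le> restr_rad V G + (e + 2 * d)"
    using restr_rad_le_restr_rad_add_hausdorff[OF assms] by simp
  finally show "v \<in> near_restr_center V G (e + 2 * d)"
    using v by (simp add: near_restr_center_def)
qed

theorem theorem3p10:
  fixes V :: "'a::banach set" and \<F> :: "'a set set"
  assumes "V \<in> CL" and "\<F> \<subseteq> CB"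
  shows "(property_lP2 V \<F> \<longleftrightarrow>
            (\<forall>\<epsilon>>0. \<forall>F\<in>\<F>. \<exists>\<delta>>0. \<forall>G\<in>\<F>. hausdorff F G < \<delta> \<longrightarrow>
               near_restr_center V F \<delta> \<subseteq> enlarge (restr_center V G) \<epsilon>))
       \<and> ((\<forall>\<epsilon>>0. \<forall>F\<in>\<F>. \<exists>\<delta>>0. \<forall>G\<in>\<F>. hausdorff F G < \<delta> \<longrightarrow>
               near_restr_center V F \<delta> \<subseteq> enlarge (restr_center V G) \<epsilon>) \<longleftrightarrow>
          (property_P1 V \<F> \<and>
             lower_hausdorff_semicontinuous \<F> hausdorff (restr_center V)))"
proof -
  let ?two = "\<forall>\<epsilon>>0. \<forall>F\<in>\<F>. \<exists>\<delta>>0. \<forall>G\<in>\<F>. hausdorff F G < \<delta> \<longrightarrow>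
    near_restr_center V F \<delta> \<subseteq> enlarge (restr_center V G) \<epsilon>"
  let ?lsc = "lower_hausdorff_semicontinuous \<F> hausdorff (restr_center V)"
  have V: "V \<noteq> {}" "closed V" using assms(1) by (auto simp: CL_def)
  have CB: "F \<in> CB" if "F \<in> \<F>" for F using assms(2) that by blast
  \<comment> \<open>The third is chosen because \<open>d / 3 + 2 * (d / 3) = d\<close>.\<close>
  have near: "near_restr_center V F (d / 3) \<subseteq> near_restr_center V G d"
    if "F \<in> \<F>" "G \<in> \<F>" "hausdorff F G < d / 3" for F G d
    using near_restr_center_subset_of_hausdorff[OF V(1) CB[OF that(1)] CB[OF that(2)] that(3), of "d / 3"]
    by simp
  have self: "hausdorff F F < d" if "d > 0" for F :: "'a set" and d
    using hausdorff_self_le[of "d / 2" F] that by simp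
  have P1_of_two: "property_P1 V \<F>" if two: ?two
    unfolding property_P1_def
  proof (intro ballI conjI allI impI)
    fix G and e :: real assume G: "G \<in> \<F>"
    \<comment> \<open>Statement (2) is applied with both sets equal to \<open>G\<close>, whose
      distance to itself is below every positive \<open>d\<close>.\<close>
    have ex: "\<exists>d>0. near_restr_center V G d \<subseteq> enlarge (restr_center V G) e" if "e > 0" for e
      using two G self that by meson
    show "\<exists>d>0. near_restr_center V G d \<subseteq> enlarge (restr_center V G) e" if "e > 0"
      using that by (rule ex)
    \<comment> \<open>The enlargement of an empty center would be empty, yet it contains a nonempty
      near-center.\<close>
    show "restr_center V G \<noteq> {}"
      using ex[of 1] near_restr_center_nonempty[OF V(1), of _ G] by fastforce
  qed
  have two_of_lP2: "?two" if lP2: "property_lP2 V \<F>"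
  proof (intro allI impI ballI)
    fix e :: real and F assume "e > 0" and F: "F \<in> \<F>"
    then obtain d where d: "d > 0" "\<And>G. G \<in> \<F> \<Longrightarrow> hausdorff F G < d \<Longrightarrow>
        near_restr_center V G d \<subseteq> enlarge (restr_center V G) e"
      using lP2 unfolding property_lP2_def by meson
    show "\<exists>d>0. \<forall>G\<in>\<F>. hausdorff F G < d \<longrightarrow>
        near_restr_center V F d \<subseteq> enlarge (restr_center V G) e"
    proof (intro exI[of _ "d / 3"] conjI ballI impI)
      fix G assume G: "G \<in> \<F>" "hausdorff F G < d / 3"
      then have "near_restr_center V F (d / 3) \<subseteq> near_restr_center V G d"
        using near F by blast
      also have "\<dots> \<subseteq> enlarge (restr_center V G) e"
        using d G by simp
      finally show "near_restr_center V F (d / 3) \<subseteq> enlarge (restr_center V G) e" .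
    qed (use d in simp)
  qed
  have lP2_of_two: "property_lP2 V \<F>" if two: ?two
    unfolding property_lP2_def
  proof (intro conjI allI impI ballI)
    show "restr_center V G \<noteq> {}" if "G \<in> \<F>" for G
      using P1_of_two[OF two] that by (simp add: property_P1_def)
    fix e :: real and F assume "e > 0" and F: "F \<in> \<F>"
    then obtain d where d: "d > 0" "\<And>G. G \<in> \<F> \<Longrightarrow> hausdorff F G < d \<Longrightarrow>
        near_restr_center V F d \<subseteq> enlarge (restr_center V G) e"
      using two by meson
    show "\<exists>d>0. \<forall>G\<in>\<F>. hausdorff F G < d \<longrightarrow>
        near_restr_center V G d \<subseteq> enlarge (restr_center V G) e"
    proof (intro exI[of _ "d / 3"] conjI ballI impI)
      fix G assume G: "G \<in> \<F>" "hausdorff F G < d / 3"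
      then have "near_restr_center V G (d / 3) \<subseteq> near_restr_center V F d"
        using near F by (simp add: hausdorff_commute)
      also have "\<dots> \<subseteq> enlarge (restr_center V G) e"
        using d G by simp
      finally show "near_restr_center V G (d / 3) \<subseteq> enlarge (restr_center V G) e" .
    qed (use d in simp)
  qed
  have lsc_of_two: "?lsc" if two: ?two
    unfolding lower_hausdorff_semicontinuous_def
  proof (intro conjI ballI allI impI Pi_I)
    show "restr_center V F \<in> CB" if "F \<in> \<F>" for F
      using P1_of_two[OF two] that closed_restr_center[OF V(2) CB[OF that]] bounded_restr_center[OF CB[OF that]]
      by (simp add: CB_def property_P1_def)
    fix F and e :: real assume "F \<in> \<F>" "e > 0"
    then obtain d where d: "d > 0" "\<And>G. G \<in> \<F> \<Longrightarrow> hausdorff F G < d \<Longrightarrow>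
        near_restr_center V F d \<subseteq> enlarge (restr_center V G) e"
      using two by meson
    show "\<exists>d>0. \<forall>G\<in>\<F>. hausdorff G F < d \<longrightarrow>
        restr_center V F \<subseteq> enlarge (restr_center V G) e"
    proof (intro exI[of _ d] conjI ballI impI)
      fix G assume G: "G \<in> \<F>" "hausdorff G F < d"
      have "restr_center V F \<subseteq> near_restr_center V F d"
        using d(1) by (simp add: restr_center_subset_near_restr_center)
      also have "\<dots> \<subseteq> enlarge (restr_center V G) e"
        using G hausdorff_commute[of F G] by (intro d(2)) simp_all
      finally show "restr_center V F \<subseteq> enlarge (restr_center V G) e" .
    qed (rule d(1))
  qed
  have two_of_P1_lsc: "?two" if P1: "property_P1 V \<F>" and lsc: ?lsc
  proof (intro allI impI ballI)
    fix e :: real and F assume e: "e > 0" and F: "F \<in> \<F>"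
    then have e2: "e / 2 > 0" by simp
    obtain d1 where d1: "d1 > 0" "near_restr_center V F d1 \<subseteq> enlarge (restr_center V F) (e / 2)"
      using P1 F e2 unfolding property_P1_def by meson
    obtain d2 where d2: "d2 > 0" "\<And>G. G \<in> \<F> \<Longrightarrow> hausdorff G F < d2 \<Longrightarrow>
        restr_center V F \<subseteq> enlarge (restr_center V G) (e / 2)"
      using lsc F e2 unfolding lower_hausdorff_semicontinuous_def by meson
    show "\<exists>d>0. \<forall>G\<in>\<F>. hausdorff F G < d \<longrightarrow>
        near_restr_center V F d \<subseteq> enlarge (restr_center V G) e"
    \<comment> \<open>Near-centers grow with their parameter, so \<open>d1\<close> handles the
      passage to the center of \<open>F\<close>, while \<open>d2\<close> controls the distance from
      \<open>F\<close> to \<open>G\<close>.\<close>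
    proof (intro exI[of _ "min d1 d2"] conjI ballI impI)
      fix G assume G: "G \<in> \<F>" "hausdorff F G < min d1 d2"
      have "near_restr_center V F (min d1 d2) \<subseteq> near_restr_center V F d1"
        by (auto simp: near_restr_center_def)
      also have "\<dots> \<subseteq> enlarge (restr_center V F) (e / 2)"
        by (rule d1)
      also have "\<dots> \<subseteq> enlarge (enlarge (restr_center V G) (e / 2)) (e / 2)"
        using G by (intro enlarge_mono d2) (auto simp: hausdorff_commute)
      also have "\<dots> \<subseteq> enlarge (restr_center V G) e"
        using enlarge_enlarge_subset[OF e2 e2] by simp
      finally show "near_restr_center V F (min d1 d2) \<subseteq> enlarge (restr_center V G) e" .
    qed (use d1 d2 in simp)
  qed
  show ?thesis
    by (intro conjI iffI; (elim conjE)?)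
      (rule two_of_lP2 lP2_of_two P1_of_two lsc_of_two two_of_P1_lsc; assumption)+
qed

end
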